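(* Let $P_{XYZ}$ be a joint probability distribution of three countable random variables $X,Y,Z$ with finite entropy. Then \[ I(X:Y \downarrow\downarrow Z) = 0 \iff I(X:Y \downarrow Z) = 0 . \]
   Context: All random variables take values in countable (possibly infinite) sets, and every probability distribution is assumed to have finite Shannon entropy. $H$ denotes Shannon entropy, with logarithms base 2. The conditional mutual information is $I(X:Y|Z) := H(X|Z)+H(Y|Z)-H(XY|Z)$. A channel $P_{\overline{Z}|Z}$ is a stochastic map (conditional distribution) from the range of $Z$ to a countable set, producing $\overline{Z}$ from $Z$ alone (so $XY - Z - \overline{Z}$ is a Markov chain). Intrinsic information: $I(X:Y\downarrow Z) := \inf_{P_{\overline{Z}|Z}} I(X:Y|\overline{Z})$, the infimum being over all channels processing $Z$. Reduced intrinsic information: $I(X:Y\downarrow\downarrow Z) := \inf_{P_{U|XYZ}} \big( I(X:Y\downarrow ZU) + H(U) \big)$, the infimum being over all conditional distributions $P_{U|XYZ}$ of an additional random variable $U$, where $ZU$ denotes the pair $(Z,U)$ regarded as a single random variable. *)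

theory Defs
  imports "HOL-Probability.Probability"
begin

text \<open>
  Random variables are functions on the discrete probability space \<^term>\<open>measure_pmf P\<close> with values
  in a countable type. The entropies are those of the library, with base 2 and the counting measure
  as reference measure; they are real-valued and hence only meaningful for variables of finite
  entropy, which is why finiteness is recorded separately.
\<close>

definition Ent :: "'o pmf \<Rightarrow> ('o \<Rightarrow> 'a::countable) \<Rightarrow> real" where
  "Ent P X = prob_space.entropy (measure_pmf P) 2 (count_space UNIV) X"

definition finite_Ent :: "'o pmf \<Rightarrow> ('o \<Rightarrow> 'a::countable) \<Rightarrow> bool" where
  "finite_Ent P X \<longleftrightarrow>
     information_space.finite_entropy (measure_pmf P) 2 (count_space UNIV) X (pmf (map_pmf X P))"

definition cond_Ent :: "'o pmf \<Rightarrow> ('o \<Rightarrow> 'a::countable) \<Rightarrow> ('o \<Rightarrow> 'c::countable) \<Rightarrow> real" where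
  "cond_Ent P X Z =
     prob_space.conditional_entropy (measure_pmf P) 2 (count_space UNIV) (count_space UNIV) X Z"

definition cond_mutual_info ::
    "'o pmf \<Rightarrow> ('o \<Rightarrow> 'x::countable) \<Rightarrow> ('o \<Rightarrow> 'y::countable) \<Rightarrow> ('o \<Rightarrow> 'z::countable) \<Rightarrow> real" where
  "cond_mutual_info P X Y Z =
     cond_Ent P X Z + cond_Ent P Y Z - cond_Ent P (\<lambda>\<omega>. (X \<omega>, Y \<omega>)) Z"

text \<open>
  The joint law of \<open>X, Y, Z'\<close>, where \<open>Z'\<close> is produced by the channel \<open>W\<close> from \<open>Z\<close> alone.
\<close>

definition process :: "('x \<times> 'y \<times> 'z) pmf \<Rightarrow> ('z \<Rightarrow> 'w pmf) \<Rightarrow> ('x \<times> 'y \<times> 'w) pmf" where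
  "process P W = do {(x, y, z) \<leftarrow> P; w \<leftarrow> W z; return_pmf (x, y, w)}"

text \<open>
  Channel outputs (and the variable \<open>U\<close> below) take values in \<^typ>\<open>nat\<close>: every countable set embeds
  into it, and entropies depend only on the law up to relabelling. As all distributions are to have
  finite entropy, channels with an output of infinite entropy are not admitted.
\<close>

definition intrinsic_info :: "('x::countable \<times> 'y::countable \<times> 'z::countable) pmf \<Rightarrow> real" where
  "intrinsic_info P =
     (INF W \<in> {W :: 'z \<Rightarrow> nat pmf. finite_Ent (process P W) (\<lambda>\<omega>. \<omega>)}.
        cond_mutual_info (process P W) (\<lambda>(x, y, w). x) (\<lambda>(x, y, w). y) (\<lambda>(x, y, w). w))"

text \<open>
  The joint law of \<open>X, Y, (Z, U)\<close>, where \<open>V\<close> is the conditional distribution of \<open>U\<close> given \<open>X, Y, Z\<close>.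
\<close>

definition adjoin :: "('x \<times> 'y \<times> 'z) pmf \<Rightarrow> ('x \<times> 'y \<times> 'z \<Rightarrow> 'u pmf) \<Rightarrow> ('x \<times> 'y \<times> 'z \<times> 'u) pmf" where
  "adjoin P V = do {(x, y, z) \<leftarrow> P; u \<leftarrow> V (x, y, z); return_pmf (x, y, z, u)}"

definition reduced_intrinsic_info ::
    "('x::countable \<times> 'y::countable \<times> 'z::countable) pmf \<Rightarrow> real" where
  "reduced_intrinsic_info P =
     (INF V \<in> {V :: 'x \<times> 'y \<times> 'z \<Rightarrow> nat pmf. finite_Ent (adjoin P V) (\<lambda>\<omega>. \<omega>)}.
        intrinsic_info (adjoin P V) + Ent (adjoin P V) (\<lambda>(x, y, z, u). u))"

text \<open>The library notions unfold to the usual series.\<close>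

lemma information_space_pmf: "information_space (measure_pmf P) 2"
  by (simp add: information_space_def information_space_axioms_def measure_pmf.prob_space_axioms)

lemma distributed_pmf:
  "distributed (measure_pmf P) (count_space UNIV) X (pmf (map_pmf X P))"
proof -
  have "distr (measure_pmf P) (count_space UNIV) X = density (count_space UNIV) (pmf (map_pmf X P))"
    by (metis map_pmf_rep_eq measure_pmf_eq_density)
  then show ?thesis
    by (auto simp: distributed_def)
qed

lemma integrable_count_space_iff_summable:
  fixes f :: "'a \<Rightarrow> real"
  shows "integrable (count_space UNIV) f \<longleftrightarrow> f summable_on UNIV"
  by (metis abs_summable_equivalent abs_summable_on_def summable_on_iff_abs_summable_on_real)

lemma integral_count_space_eq_infsum:
  fixes f :: "'a \<Rightarrow> real"
  shows "(\<integral>x. f x \<partial>count_space UNIV) = (\<Sum>\<^sub>\<infinity>x. f x)"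
proof (cases "f summable_on UNIV")
  case True
  then have "Infinite_Set_Sum.abs_summable_on f UNIV"
    unfolding abs_summable_on_def integrable_count_space_iff_summable .
  from infsetsum_infsum[OF this] show ?thesis
    unfolding infsetsum_def .
next
  case False
  then have "\<not> integrable (count_space UNIV) f"
    unfolding integrable_count_space_iff_summable .
  with False show ?thesis
    by (simp add: not_integrable_integral_eq infsum_not_exists)
qed

lemma finite_Ent_iff:
  "finite_Ent P X \<longleftrightarrow> (\<lambda>a. pmf (map_pmf X P) a * log 2 (pmf (map_pmf X P) a)) summable_on UNIV"
  unfolding finite_Ent_def information_space.finite_entropy_def[OF information_space_pmf]
    integrable_count_space_iff_summable
  using distributed_pmf[of P X] by simp

lemma Ent_eq:
  "Ent P X = - (\<Sum>\<^sub>\<infinity>a. pmf (map_pmf X P) a * log 2 (pmf (map_pmf X P) a))"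
  unfolding Ent_def
  by (subst information_space.entropy_distr[OF information_space_pmf distributed_pmf])
     (simp_all add: integral_count_space_eq_infsum)

lemma cond_Ent_eq:
  fixes X :: "'o \<Rightarrow> 'a::countable" and Z :: "'o \<Rightarrow> 'c::countable"
  shows "cond_Ent P X Z =
     - (\<Sum>\<^sub>\<infinity>(a, c). pmf (map_pmf (\<lambda>\<omega>. (X \<omega>, Z \<omega>)) P) (a, c) *
          log 2 (pmf (map_pmf (\<lambda>\<omega>. (X \<omega>, Z \<omega>)) P) (a, c) / pmf (map_pmf Z P) c))"
proof -
  interpret information_space "measure_pmf P" 2 by (rule information_space_pmf)
  have pair: "count_space UNIV \<Otimes>\<^sub>M count_space UNIV = count_space (UNIV :: ('a \<times> 'c) set)"
    by (simp add: pair_measure_countable)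
  have "distributed (measure_pmf P) (count_space UNIV \<Otimes>\<^sub>M count_space UNIV) (\<lambda>\<omega>. (X \<omega>, Z \<omega>))
      (pmf (map_pmf (\<lambda>\<omega>. (X \<omega>, Z \<omega>)) P))"
    unfolding pair by (rule distributed_pmf)
  then show ?thesis
    unfolding cond_Ent_def
    by (subst conditional_entropy_generic_eq[OF _ _ distributed_pmf])
       (auto simp: sigma_finite_measure_count_space_countable pair integral_count_space_eq_infsum)
qed

end

theory Submission
  imports Defs
begin

text \<open>Let \<open>U\<close> and the channel \<open>W\<close> on \<open>(Z, U)\<close> make both \<open>H(U)\<close> and the conditional mutual information
  small. Then \<open>U\<close> has an atom \<open>u\<^sub>0\<close> of mass close to one, and fixing \<open>U = u\<^sub>0\<close> gives a channel from \<open>Z\<close>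
  alone whose output can be coupled to that of \<open>W\<close> so that the two differ with small probability. The alphabets being infinite, conditional mutual information is not continuous in
  general; but here the law of \<open>X\<close> stays fixed. Let \<open>G\<close> reveal \<open>X\<close> where the two outputs differ and
  nothing elsewhere. Given \<open>G\<close> in addition, both conditional mutual informations coincide, and
  adding \<open>G\<close> to the condition changes each by at most \<open>H(G)\<close>, which is small because \<open>X\<close> has finite
  entropy.\<close>

section \<open>Entropy as expected surprisal\<close>

text \<open>Defined on sample points rather than on values, so that entropies of different variables
  become expectations over one space and can be compared pointwise. Only the partition into fibres
  of \<open>X\<close> enters.\<close>

definition surprisal :: "'o pmf \<Rightarrow> ('o \<Rightarrow> 'a) \<Rightarrow> 'o \<Rightarrow> real" where
  "surprisal Q X \<omega> = - log 2 (measure_pmf.prob Q {\<omega>'. X \<omega>' = X \<omega>})"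

lemma pmf_map_eq_prob: "pmf (map_pmf X Q) a = measure_pmf.prob Q {\<omega>. X \<omega> = a}"
  by (simp add: pmf_map vimage_def)

lemma prob_fibre_pos:
  assumes "\<omega> \<in> set_pmf Q"
  shows "0 < measure_pmf.prob Q {\<omega>'. X \<omega>' = X \<omega>}"
  using assms unfolding pmf_map_eq_prob[symmetric] pmf_positive_iff set_map_pmf by blast

text \<open>At a sample point whose fibre is a null set, the convention \<open>log 2 0 = 0\<close>
  keeps the claim true.\<close>

lemma surprisal_nonneg: "0 \<le> surprisal Q X \<omega>"
proof (cases "measure_pmf.prob Q {\<omega>'. X \<omega>' = X \<omega>} = 0")
  case True
  then show ?thesis by (simp add: surprisal_def log_def)
next
  case False
  then have "0 < measure_pmf.prob Q {\<omega>'. X \<omega>' = X \<omega>}"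
    by (simp add: zero_less_measure_iff)
  then show ?thesis by (simp add: surprisal_def)
qed

lemma integrable_measure_pmf_iff:
  fixes f :: "'a \<Rightarrow> real"
  shows "integrable (measure_pmf M) f \<longleftrightarrow> (\<lambda>x. pmf M x * f x) summable_on UNIV"
  unfolding integrable_count_space_iff_summable[symmetric]
  by (subst measure_pmf_eq_density, subst integrable_density) auto

lemma integral_measure_pmf_eq_infsum:
  fixes f :: "'a \<Rightarrow> real"
  shows "measure_pmf.expectation M f = (\<Sum>\<^sub>\<infinity>x. pmf M x * f x)"
  unfolding integral_count_space_eq_infsum[symmetric]
  by (subst measure_pmf_eq_density, subst integral_density) auto

lemma finite_Ent_iff_integrable:
  "finite_Ent Q X \<longleftrightarrow> integrable (measure_pmf Q) (surprisal Q X)"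
proof -
  have "integrable (measure_pmf Q) (surprisal Q X) \<longleftrightarrow>
      integrable (measure_pmf Q) (\<lambda>\<omega>. log 2 (pmf (map_pmf X Q) (X \<omega>)))"
    unfolding surprisal_def pmf_map_eq_prob by simp
  then show ?thesis
    unfolding finite_Ent_iff integrable_measure_pmf_iff[symmetric] integrable_map_pmf_eq by simp
qed

lemma Ent_eq_expectation: "Ent Q X = measure_pmf.expectation Q (surprisal Q X)"
proof -
  have "measure_pmf.expectation (map_pmf X Q) (\<lambda>a. log 2 (pmf (map_pmf X Q) a))
      = measure_pmf.expectation Q (\<lambda>\<omega>. log 2 (pmf (map_pmf X Q) (X \<omega>)))"
    by (rule integral_map_pmf)
  also have "\<dots> = - measure_pmf.expectation Q (surprisal Q X)"
    unfolding surprisal_def pmf_map_eq_prob by simp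
  finally show ?thesis
    unfolding Ent_eq integral_measure_pmf_eq_infsum[symmetric] by simp
qed

text \<open>On the support both fibres have positive probability, so the logarithm of the quotient
  splits there. The difference stays under one integral, so that the identity covers infinite
  entropies too.\<close>

lemma cond_Ent_eq_expectation:
  "cond_Ent Q X Z = measure_pmf.expectation Q (\<lambda>\<omega>. surprisal Q (\<lambda>\<omega>. (X \<omega>, Z \<omega>)) \<omega> - surprisal Q Z \<omega>)"
proof -
  let ?T = "\<lambda>\<omega>. (X \<omega>, Z \<omega>)"
  have "cond_Ent Q X Z = - measure_pmf.expectation (map_pmf ?T Q)
      (\<lambda>(a, c). log 2 (pmf (map_pmf ?T Q) (a, c) / pmf (map_pmf Z Q) c))"
    unfolding cond_Ent_eq integral_measure_pmf_eq_infsum by (simp add: case_prod_unfold)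
  also have "\<dots> = measure_pmf.expectation Q
      (\<lambda>\<omega>. - log 2 (pmf (map_pmf ?T Q) (?T \<omega>) / pmf (map_pmf Z Q) (Z \<omega>)))"
    by (subst integral_map_pmf) simp
  also have "\<dots> = measure_pmf.expectation Q (\<lambda>\<omega>. surprisal Q ?T \<omega> - surprisal Q Z \<omega>)"
  proof (rule integral_cong_AE)
    show "AE \<omega> in measure_pmf Q.
        - log 2 (pmf (map_pmf ?T Q) (?T \<omega>) / pmf (map_pmf Z Q) (Z \<omega>)) = surprisal Q ?T \<omega> - surprisal Q Z \<omega>"
      unfolding AE_measure_pmf_iff surprisal_def pmf_map_eq_prob
    proof
      fix \<omega> assume "\<omega> \<in> set_pmf Q"
      then show "- log 2 (measure_pmf.prob Q {\<omega>'. ?T \<omega>' = ?T \<omega>} / measure_pmf.prob Q {\<omega>'. Z \<omega>' = Z \<omega>})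
        = - log 2 (measure_pmf.prob Q {\<omega>'. ?T \<omega>' = ?T \<omega>}) - - log 2 (measure_pmf.prob Q {\<omega>'. Z \<omega>' = Z \<omega>})"
        using prob_fibre_pos[of \<omega> Q ?T] prob_fibre_pos[of \<omega> Q Z]
        by (simp add: log_divide del: prod.inject)
    qed
  qed auto
  finally show ?thesis .
qed

lemma Ent_map_pmf: "Ent (map_pmf f Q) X = Ent Q (\<lambda>\<omega>. X (f \<omega>))"
  unfolding Ent_eq by (simp add: map_pmf_comp)

lemma finite_Ent_map_pmf: "finite_Ent (map_pmf f Q) X \<longleftrightarrow> finite_Ent Q (\<lambda>\<omega>. X (f \<omega>))"
  unfolding finite_Ent_iff by (simp add: map_pmf_comp)

lemma cond_mutual_info_map_pmf:
  "cond_mutual_info (map_pmf f Q) X Y Z = cond_mutual_info Q (\<lambda>\<omega>. X (f \<omega>)) (\<lambda>\<omega>. Y (f \<omega>)) (\<lambda>\<omega>. Z (f \<omega>))"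
  unfolding cond_mutual_info_def cond_Ent_eq by (simp add: map_pmf_comp)

section \<open>Shannon inequalities\<close>

text \<open>\<open>Y\<close> is a function of \<open>X\<close>, so each fibre of \<open>X\<close>
  lies inside a fibre of \<open>Y\<close>. Restricting to the support excludes null fibres of
  \<open>X\<close>, whose surprisal is 0 by convention.\<close>

lemma surprisal_mono:
  assumes "\<And>\<omega> \<omega>'. X \<omega> = X \<omega>' \<Longrightarrow> Y \<omega> = Y \<omega>'" and "\<omega> \<in> set_pmf Q"
  shows "surprisal Q Y \<omega> \<le> surprisal Q X \<omega>"
proof -
  have "measure_pmf.prob Q {\<omega>'. X \<omega>' = X \<omega>} \<le> measure_pmf.prob Q {\<omega>'. Y \<omega>' = Y \<omega>}"
  proof (rule measure_pmf.finite_measure_mono)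
    show "{\<omega>'. X \<omega>' = X \<omega>} \<subseteq> {\<omega>'. Y \<omega>' = Y \<omega>}"
      using assms(1) by blast
  qed simp
  then show ?thesis
    using prob_fibre_pos[OF assms(2), of X] by (simp add: surprisal_def)
qed

lemma finite_Ent_mono:
  assumes "finite_Ent Q X" and "\<And>\<omega> \<omega>'. X \<omega> = X \<omega>' \<Longrightarrow> Y \<omega> = Y \<omega>'"
  shows "finite_Ent Q Y"
  unfolding finite_Ent_iff_integrable
proof (rule Bochner_Integration.integrable_bound)
  show "integrable (measure_pmf Q) (surprisal Q X)"
    using assms(1) unfolding finite_Ent_iff_integrable .
  show "AE \<omega> in measure_pmf Q. norm (surprisal Q Y \<omega>) \<le> norm (surprisal Q X \<omega>)"
    using surprisal_mono[of X Y, OF assms(2)]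
    by (simp add: AE_measure_pmf_iff abs_of_nonneg[OF surprisal_nonneg])
qed auto

lemma Ent_mono:
  assumes "finite_Ent Q X" and "\<And>\<omega> \<omega>'. X \<omega> = X \<omega>' \<Longrightarrow> Y \<omega> = Y \<omega>'"
  shows "Ent Q Y \<le> Ent Q X"
  unfolding Ent_eq_expectation
proof (rule integral_mono_AE)
  show "AE \<omega> in measure_pmf Q. surprisal Q Y \<omega> \<le> surprisal Q X \<omega>"
    using surprisal_mono[of X Y, OF assms(2)] by (simp add: AE_measure_pmf_iff)
qed (use assms(1) finite_Ent_mono[OF assms] in \<open>simp_all only: finite_Ent_iff_integrable\<close>)

lemma Ent_nonneg: "0 \<le> Ent Q X"
  unfolding Ent_eq_expectation by (simp add: surprisal_nonneg)

text \<open>After passing to the law of \<open>X\<close>, its weights cancel the denominator; atoms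
  of weight zero contribute nothing on the left, whence an inequality. This is the change of measure
  behind Gibbs' inequality: the density of \<open>g\<close> relative to the law of \<open>X\<close>
  has mean at most the total mass of \<open>g\<close>.\<close>

lemma nn_integral_divide_pmf_le:
  assumes "\<And>a. 0 \<le> g a"
  shows "(\<integral>\<^sup>+\<omega>. ennreal (g (X \<omega>) / measure_pmf.prob Q {\<omega>'. X \<omega>' = X \<omega>}) \<partial>measure_pmf Q)
    \<le> (\<integral>\<^sup>+a. ennreal (g a) \<partial>count_space UNIV)"
proof -
  let ?p = "pmf (map_pmf X Q)"
  have "(\<integral>\<^sup>+\<omega>. ennreal (g (X \<omega>) / measure_pmf.prob Q {\<omega>'. X \<omega>' = X \<omega>}) \<partial>measure_pmf Q)
      = (\<integral>\<^sup>+a. ennreal (g a / ?p a) \<partial>measure_pmf (map_pmf X Q))"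
    by (simp add: pmf_map_eq_prob)
  also have "\<dots> = (\<integral>\<^sup>+a. ennreal (?p a) * ennreal (g a / ?p a) \<partial>count_space UNIV)"
    by (rule nn_integral_measure_pmf)
  also have "\<dots> \<le> (\<integral>\<^sup>+a. ennreal (g a) \<partial>count_space UNIV)"
  proof (rule nn_integral_mono)
    fix a
    have "ennreal (?p a) * ennreal (g a / ?p a) = ennreal (?p a * (g a / ?p a))"
      by (rule ennreal_mult'[symmetric]) simp
    also have "\<dots> \<le> ennreal (g a)"
      using assms[of a] by (intro ennreal_leI) (auto simp: field_simps)
    finally show "ennreal (?p a) * ennreal (g a / ?p a) \<le> ennreal (g a)" .
  qed
  finally show ?thesis .
qed

text \<open>Besides giving marginals, this serves with a constant \<open>Z\<close> as the
  normalisation of the law of \<open>X\<close>.\<close>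

lemma nn_integral_pmf_marginal:
  "(\<integral>\<^sup>+a. ennreal (measure_pmf.prob Q {\<omega>. X \<omega> = a \<and> Z \<omega> = c}) \<partial>count_space UNIV)
    = ennreal (measure_pmf.prob Q {\<omega>. Z \<omega> = c})"
proof -
  let ?M = "map_pmf (\<lambda>\<omega>. (X \<omega>, Z \<omega>)) Q"
  have "(\<integral>\<^sup>+a. ennreal (measure_pmf.prob Q {\<omega>. X \<omega> = a \<and> Z \<omega> = c}) \<partial>count_space UNIV)
      = (\<integral>\<^sup>+a. ennreal (pmf ?M (a, c)) \<partial>count_space UNIV)"
    by (simp add: pmf_map_eq_prob)
  also have "\<dots> = (\<integral>\<^sup>+p. ennreal (pmf ?M p) \<partial>count_space (range (\<lambda>a. (a, c))))"
    by (rule nn_integral_bij_count_space) (simp add: inj_on_def bij_betw_def)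
  also have "\<dots> = emeasure (measure_pmf ?M) (range (\<lambda>a. (a, c)))"
    by (rule nn_integral_pmf)
  also have "\<dots> = emeasure (measure_pmf Q) {\<omega>. Z \<omega> = c}"
    by (auto intro!: arg_cong[where f = "emeasure (measure_pmf Q)"])
  finally show ?thesis by (simp add: measure_pmf.emeasure_eq_measure)
qed

text \<open>The law of the pair is compared with \<open>g\<close>, the product of the law of
  \<open>X\<close> and counting measure on the finite range of \<open>B\<close>. Its mass is finite,
  so the density \<open>r\<close> is integrable, and \<open>ln t \<le> t\<close> bounds the
  surprisal of the pair by that of \<open>X\<close> plus \<open>r / ln 2\<close>.\<close>

lemma finite_Ent_Pair_finite_range:
  fixes X :: "'o \<Rightarrow> 'a::countable" and B :: "'o \<Rightarrow> 'b::countable"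
  assumes X: "finite_Ent Q X" and B: "finite (range B)"
  shows "finite_Ent Q (\<lambda>\<omega>. (X \<omega>, B \<omega>))"
proof -
  let ?T = "\<lambda>\<omega>. (X \<omega>, B \<omega>)"
  define pX where "pX a = measure_pmf.prob Q {\<omega>'. X \<omega>' = a}" for a
  define g where "g = (\<lambda>(a, b). pX a * indicator (range B) b)"
  define r where "r \<omega> = g (?T \<omega>) / measure_pmf.prob Q {\<omega>'. ?T \<omega>' = ?T \<omega>}" for \<omega>
  have pX_sum: "(\<integral>\<^sup>+a. ennreal (pX a) \<partial>count_space UNIV) = 1"
    using nn_integral_pmf_marginal[where Q = Q and X = X and Z = "\<lambda>_. ()" and c = "()"]
    by (simp add: pX_def)
  have "(\<integral>\<^sup>+\<omega>. ennreal (r \<omega>) \<partial>measure_pmf Q) \<le> (\<integral>\<^sup>+p. ennreal (g p) \<partial>count_space UNIV)"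
    unfolding r_def by (rule nn_integral_divide_pmf_le) (auto simp: g_def pX_def)
  also have "\<dots> = (\<integral>\<^sup>+b. \<integral>\<^sup>+a. ennreal (g (a, b)) \<partial>count_space UNIV \<partial>count_space UNIV)"
    by (rule nn_integral_snd_count_space[symmetric])
  also have "\<dots> = (\<integral>\<^sup>+b. indicator (range B) b \<partial>count_space UNIV)"
    by (rule nn_integral_cong) (simp add: g_def pX_sum indicator_def)
  also have "\<dots> = of_nat (card (range B))"
    using B by (simp add: emeasure_count_space_finite)
  also have "\<dots> < \<infinity>" by (simp add: of_nat_less_top)
  finally have "integrable (measure_pmf Q) r"
    by (intro integrableI_nonneg) (auto simp: r_def g_def pX_def)
  then have "integrable (measure_pmf Q) (\<lambda>\<omega>. surprisal Q X \<omega> + r \<omega> / ln 2)"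
    using X by (simp add: finite_Ent_iff_integrable)
  then show ?thesis
    unfolding finite_Ent_iff_integrable
  proof (rule Bochner_Integration.integrable_bound)
    show "AE \<omega> in measure_pmf Q. norm (surprisal Q ?T \<omega>) \<le> norm (surprisal Q X \<omega> + r \<omega> / ln 2)"
      unfolding AE_measure_pmf_iff
    proof
      fix \<omega> assume \<omega>: "\<omega> \<in> set_pmf Q"
      define s where "s = measure_pmf.prob Q {\<omega>'. ?T \<omega>' = ?T \<omega>}"
      have pos: "0 < pX (X \<omega>)" "0 < s"
        using prob_fibre_pos[OF \<omega>, of X] prob_fibre_pos[OF \<omega>, of ?T] by (simp_all add: pX_def s_def)
      have r: "r \<omega> = pX (X \<omega>) / s"
        by (simp add: r_def g_def s_def)
      have "ln (pX (X \<omega>) / s) \<le> pX (X \<omega>) / s"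
        using pos by (intro order_trans[OF ln_le_minus_one]) auto
      then have "log 2 (pX (X \<omega>) / s) \<le> r \<omega> / ln 2"
        using divide_right_mono[of "ln (pX (X \<omega>) / s)" "pX (X \<omega>) / s" "ln 2"]
        by (simp add: log_def r)
      then have "surprisal Q ?T \<omega> \<le> surprisal Q X \<omega> + r \<omega> / ln 2"
        using pos by (simp add: surprisal_def log_divide s_def[symmetric] pX_def[symmetric] del: prod.inject)
      then show "norm (surprisal Q ?T \<omega>) \<le> norm (surprisal Q X \<omega> + r \<omega> / ln 2)"
        using surprisal_nonneg[of Q ?T \<omega>] by simp
    qed
  qed auto
qed

text \<open>Gibbs' inequality: the law of \<open>(X, Y, Z)\<close> is compared with
  \<open>g\<close>, which has the same marginals on \<open>(X, Z)\<close> and \<open>(Y, Z)\<close>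
  but makes \<open>X\<close> and \<open>Y\<close> independent given \<open>Z\<close>. As
  \<open>g\<close> has total mass one, its density \<open>r\<close> has mean at most 1, and
  \<open>1 - r \<le> - ln r\<close> on the support gives the claim.\<close>

lemma Ent_submodular:
  fixes X :: "'o \<Rightarrow> 'a::countable" and Y :: "'o \<Rightarrow> 'b::countable" and Z :: "'o \<Rightarrow> 'c::countable"
  assumes fin: "finite_Ent Q (\<lambda>\<omega>. (X \<omega>, Y \<omega>, Z \<omega>))"
  shows "Ent Q (\<lambda>\<omega>. (X \<omega>, Y \<omega>, Z \<omega>)) + Ent Q Z \<le> Ent Q (\<lambda>\<omega>. (X \<omega>, Z \<omega>)) + Ent Q (\<lambda>\<omega>. (Y \<omega>, Z \<omega>))"
proof -
  let ?T = "\<lambda>\<omega>. (X \<omega>, Y \<omega>, Z \<omega>)"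
  let ?XZ = "\<lambda>\<omega>. (X \<omega>, Z \<omega>)" and ?YZ = "\<lambda>\<omega>. (Y \<omega>, Z \<omega>)"
  define pXZ where "pXZ a c = measure_pmf.prob Q {\<omega>. X \<omega> = a \<and> Z \<omega> = c}" for a c
  define pYZ where "pYZ b c = measure_pmf.prob Q {\<omega>. Y \<omega> = b \<and> Z \<omega> = c}" for b c
  define pZ where "pZ c = measure_pmf.prob Q {\<omega>. Z \<omega> = c}" for c
  define g where "g = (\<lambda>(a, b, c). pXZ a c * pYZ b c / pZ c)"
  define r where "r \<omega> = g (?T \<omega>) / measure_pmf.prob Q {\<omega>'. ?T \<omega>' = ?T \<omega>}" for \<omega>
  have nonneg: "0 \<le> pXZ a c" "0 \<le> pYZ b c" "0 \<le> pZ c" for a b c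
    by (simp_all add: pXZ_def pYZ_def pZ_def)
  have r_nonneg: "0 \<le> r \<omega>" for \<omega>
    by (simp add: r_def g_def nonneg)
  have Zsum: "(\<integral>\<^sup>+c. ennreal (pZ c) \<partial>count_space UNIV) = 1"
    using nn_integral_pmf_marginal[where Q = Q and X = Z and Z = "\<lambda>_. ()" and c = "()"]
    by (simp add: pZ_def)
  have "(\<integral>\<^sup>+\<omega>. ennreal (r \<omega>) \<partial>measure_pmf Q) \<le> (\<integral>\<^sup>+p. ennreal (g p) \<partial>count_space UNIV)"
    unfolding r_def by (rule nn_integral_divide_pmf_le) (auto simp: g_def nonneg)
  also have "\<dots> = (\<integral>\<^sup>+a. \<integral>\<^sup>+q. ennreal (g (a, q)) \<partial>count_space UNIV \<partial>count_space UNIV)"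
    by (rule nn_integral_fst_count_space[symmetric])
  also have "\<dots> = (\<integral>\<^sup>+a. \<integral>\<^sup>+c. \<integral>\<^sup>+b. ennreal (g (a, b, c)) \<partial>count_space UNIV \<partial>count_space UNIV \<partial>count_space UNIV)"
    by (intro nn_integral_cong nn_integral_snd_count_space[symmetric])
  also have "\<dots> = (\<integral>\<^sup>+a. \<integral>\<^sup>+c. ennreal (pXZ a c) \<partial>count_space UNIV \<partial>count_space UNIV)"
  proof (intro nn_integral_cong)
    fix a c
    have "(\<integral>\<^sup>+b. ennreal (g (a, b, c)) \<partial>count_space UNIV)
        = (\<integral>\<^sup>+b. ennreal (pXZ a c / pZ c) * ennreal (pYZ b c) \<partial>count_space UNIV)"
      by (intro nn_integral_cong) (simp add: g_def nonneg ennreal_mult'[symmetric])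
    also have "\<dots> = ennreal (pXZ a c / pZ c) * ennreal (pZ c)"
      by (subst nn_integral_cmult) (simp_all add: pYZ_def pZ_def nn_integral_pmf_marginal)
    also have "\<dots> = ennreal (pXZ a c / pZ c * pZ c)"
      by (rule ennreal_mult''[symmetric]) (rule nonneg)
    \<comment> \<open>If \<open>pZ c\<close> vanishes then so does \<open>pXZ a c\<close>, which
      makes the convention for division by zero harmless.\<close>
    also have "pXZ a c / pZ c * pZ c = pXZ a c"
    proof -
      have "pXZ a c \<le> pZ c"
        unfolding pXZ_def pZ_def by (intro measure_pmf.finite_measure_mono) auto
      then show ?thesis using nonneg(1)[of a c] by (cases "pZ c = 0") auto
    qed
    finally show "(\<integral>\<^sup>+b. ennreal (g (a, b, c)) \<partial>count_space UNIV) = ennreal (pXZ a c)" .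
  qed
  also have "\<dots> = (\<integral>\<^sup>+p. ennreal (case p of (a, c) \<Rightarrow> pXZ a c) \<partial>count_space UNIV)"
    by (subst nn_integral_fst_count_space[symmetric]) simp
  also have "\<dots> = (\<integral>\<^sup>+c. \<integral>\<^sup>+a. ennreal (pXZ a c) \<partial>count_space UNIV \<partial>count_space UNIV)"
    by (subst nn_integral_snd_count_space[symmetric]) simp
  also have "\<dots> = 1"
    using Zsum by (simp add: pXZ_def pZ_def nn_integral_pmf_marginal)
  finally have r_le: "(\<integral>\<^sup>+\<omega>. ennreal (r \<omega>) \<partial>measure_pmf Q) \<le> 1" .
  then have r_int: "integrable (measure_pmf Q) r"
    by (intro integrableI_nonneg) (simp_all add: r_nonneg le_less_trans[OF r_le])
  have Er: "measure_pmf.expectation Q r \<le> 1"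
    using r_le by (subst (asm) nn_integral_eq_integral[OF r_int]) (auto simp: r_nonneg)
  have ints: "integrable (measure_pmf Q) (surprisal Q ?T)" "integrable (measure_pmf Q) (surprisal Q ?XZ)"
    "integrable (measure_pmf Q) (surprisal Q ?YZ)" "integrable (measure_pmf Q) (surprisal Q Z)"
    using fin finite_Ent_mono[OF fin, of ?XZ] finite_Ent_mono[OF fin, of ?YZ] finite_Ent_mono[OF fin, of Z]
    by (simp_all add: finite_Ent_iff_integrable)
  have "0 \<le> measure_pmf.expectation Q (\<lambda>\<omega>. (1 - r \<omega>) / ln 2)"
    using Er by (simp add: r_int)
  also have "\<dots> \<le> measure_pmf.expectation Q
      (\<lambda>\<omega>. surprisal Q ?XZ \<omega> + surprisal Q ?YZ \<omega> - surprisal Q ?T \<omega> - surprisal Q Z \<omega>)"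
  proof (rule integral_mono_AE)
    show "AE \<omega> in measure_pmf Q. (1 - r \<omega>) / ln 2
        \<le> surprisal Q ?XZ \<omega> + surprisal Q ?YZ \<omega> - surprisal Q ?T \<omega> - surprisal Q Z \<omega>"
      unfolding AE_measure_pmf_iff
    proof
      fix \<omega> assume \<omega>: "\<omega> \<in> set_pmf Q"
      define s where "s = measure_pmf.prob Q {\<omega>'. ?T \<omega>' = ?T \<omega>}"
      have pos: "0 < s" "0 < pXZ (X \<omega>) (Z \<omega>)" "0 < pYZ (Y \<omega>) (Z \<omega>)" "0 < pZ (Z \<omega>)"
        using prob_fibre_pos[OF \<omega>, of ?T] prob_fibre_pos[OF \<omega>, of ?XZ]
          prob_fibre_pos[OF \<omega>, of ?YZ] prob_fibre_pos[OF \<omega>, of Z]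
        by (simp_all add: s_def pXZ_def pYZ_def pZ_def)
      have r: "r \<omega> = pXZ (X \<omega>) (Z \<omega>) * pYZ (Y \<omega>) (Z \<omega>) / pZ (Z \<omega>) / s"
        by (simp add: r_def g_def s_def)
      have "ln (r \<omega>) \<le> r \<omega> - 1"
        using pos by (intro ln_le_minus_one) (simp add: r)
      then have "(1 - r \<omega>) / ln 2 \<le> - log 2 (r \<omega>)"
        using divide_right_mono[of "1 - r \<omega>" "- ln (r \<omega>)" "ln 2"] by (simp add: log_def)
      also have "\<dots> = surprisal Q ?XZ \<omega> + surprisal Q ?YZ \<omega> - surprisal Q ?T \<omega> - surprisal Q Z \<omega>"
        using pos unfolding r
        by (simp add: surprisal_def log_divide log_mult s_def pXZ_def pYZ_def pZ_def)
      finally show "(1 - r \<omega>) / ln 2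
        \<le> surprisal Q ?XZ \<omega> + surprisal Q ?YZ \<omega> - surprisal Q ?T \<omega> - surprisal Q Z \<omega>" .
    qed
  qed (use ints r_int in auto)
  also have "\<dots> = Ent Q ?XZ + Ent Q ?YZ - Ent Q ?T - Ent Q Z"
    using ints by (simp add: Ent_eq_expectation)
  finally show ?thesis by simp
qed

section \<open>Conditional mutual information in terms of entropies\<close>

lemma surprisal_cong:
  assumes "\<And>\<omega>'. X \<omega>' = X \<omega> \<longleftrightarrow> X' \<omega>' = X' \<omega>"
  shows "surprisal Q X \<omega> = surprisal Q X' \<omega>"
  unfolding surprisal_def using assms by simp

lemma Ent_cong_fibres:
  assumes "\<And>\<omega> \<omega>'. X \<omega> = X \<omega>' \<longleftrightarrow> Y \<omega> = Y \<omega>'"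
  shows "Ent Q X = Ent Q Y"
  unfolding Ent_eq_expectation using assms by (intro Bochner_Integration.integral_cong surprisal_cong) auto

text \<open>Finite entropy of the triple makes all four surprisals integrable. The first form
  compares information densities at single sample points; the second feeds the Shannon
  inequalities.\<close>

lemma cond_mutual_info_eq_expectation:
  fixes X :: "'o \<Rightarrow> 'a::countable" and Y :: "'o \<Rightarrow> 'b::countable" and Z :: "'o \<Rightarrow> 'c::countable"
  assumes fin: "finite_Ent Q (\<lambda>\<omega>. (X \<omega>, Y \<omega>, Z \<omega>))"
  shows "cond_mutual_info Q X Y Z = measure_pmf.expectation Q (\<lambda>\<omega>.
      surprisal Q (\<lambda>\<omega>. (X \<omega>, Z \<omega>)) \<omega> + surprisal Q (\<lambda>\<omega>. (Y \<omega>, Z \<omega>)) \<omega>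
      - surprisal Q (\<lambda>\<omega>. (X \<omega>, Y \<omega>, Z \<omega>)) \<omega> - surprisal Q Z \<omega>)"
    and "cond_mutual_info Q X Y Z = Ent Q (\<lambda>\<omega>. (X \<omega>, Z \<omega>)) + Ent Q (\<lambda>\<omega>. (Y \<omega>, Z \<omega>))
      - Ent Q (\<lambda>\<omega>. (X \<omega>, Y \<omega>, Z \<omega>)) - Ent Q Z"
proof -
  let ?T = "\<lambda>\<omega>. (X \<omega>, Y \<omega>, Z \<omega>)"
  let ?XZ = "\<lambda>\<omega>. (X \<omega>, Z \<omega>)" and ?YZ = "\<lambda>\<omega>. (Y \<omega>, Z \<omega>)"
  have ints: "integrable (measure_pmf Q) (surprisal Q ?T)" "integrable (measure_pmf Q) (surprisal Q ?XZ)"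
    "integrable (measure_pmf Q) (surprisal Q ?YZ)" "integrable (measure_pmf Q) (surprisal Q Z)"
    using fin finite_Ent_mono[OF fin, of ?XZ] finite_Ent_mono[OF fin, of ?YZ] finite_Ent_mono[OF fin, of Z]
    by (simp_all add: finite_Ent_iff_integrable)
  have "surprisal Q (\<lambda>\<omega>. ((X \<omega>, Y \<omega>), Z \<omega>)) = surprisal Q ?T"
    by (intro ext surprisal_cong) auto
  then show "cond_mutual_info Q X Y Z = Ent Q ?XZ + Ent Q ?YZ - Ent Q ?T - Ent Q Z"
    unfolding cond_mutual_info_def cond_Ent_eq_expectation Ent_eq_expectation using ints by simp
  then show "cond_mutual_info Q X Y Z = measure_pmf.expectation Q (\<lambda>\<omega>.
      surprisal Q ?XZ \<omega> + surprisal Q ?YZ \<omega> - surprisal Q ?T \<omega> - surprisal Q Z \<omega>)"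
    unfolding Ent_eq_expectation using ints by simp
qed

lemma cond_mutual_info_nonneg:
  assumes "finite_Ent Q (\<lambda>\<omega>. (X \<omega>, Y \<omega>, Z \<omega>))"
  shows "0 \<le> cond_mutual_info Q X Y Z"
  using Ent_submodular[OF assms] cond_mutual_info_eq_expectation(2)[OF assms] by linarith

text \<open>Subadditivity is submodularity with a constant as the third variable.\<close>

lemma Ent_Pair_le:
  assumes "finite_Ent Q (\<lambda>\<omega>. (X \<omega>, Y \<omega>))"
  shows "Ent Q (\<lambda>\<omega>. (X \<omega>, Y \<omega>)) \<le> Ent Q X + Ent Q Y"
proof -
  let ?u = "\<lambda>_. ()"
  have "finite_Ent Q (\<lambda>\<omega>. (X \<omega>, Y \<omega>, ?u \<omega>))"
    by (rule finite_Ent_mono[OF assms]) auto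
  from Ent_submodular[OF this]
  have "Ent Q (\<lambda>\<omega>. (X \<omega>, Y \<omega>, ())) + Ent Q ?u \<le> Ent Q (\<lambda>\<omega>. (X \<omega>, ())) + Ent Q (\<lambda>\<omega>. (Y \<omega>, ()))" .
  moreover have "Ent Q (\<lambda>\<omega>. (X \<omega>, Y \<omega>, ())) = Ent Q (\<lambda>\<omega>. (X \<omega>, Y \<omega>))"
    "Ent Q (\<lambda>\<omega>. (X \<omega>, ())) = Ent Q X" "Ent Q (\<lambda>\<omega>. (Y \<omega>, ())) = Ent Q Y"
    by (intro Ent_cong_fibres; auto)+
  ultimately show ?thesis using Ent_nonneg[of Q ?u] by linarith
qed

text \<open>The difference is H(G|XZ) + H(G|YZ) - H(G|XYZ) - H(G|Z). Conditioning lowers entropy, so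
  H(G|XZ) \<le> H(G|Z) and H(G|XYZ) \<le> H(G|YZ). Since each term lies between 0 and H(G), both
  bounds follow.\<close>

lemma abs_cond_mutual_info_Pair_diff_le:
  fixes X :: "'o \<Rightarrow> 'a::countable" and Y :: "'o \<Rightarrow> 'b::countable" and Z :: "'o \<Rightarrow> 'c::countable"
    and G :: "'o \<Rightarrow> 'd::countable"
  assumes fin: "finite_Ent Q (\<lambda>\<omega>. (X \<omega>, Y \<omega>, Z \<omega>, G \<omega>))"
  shows "\<bar>cond_mutual_info Q X Y (\<lambda>\<omega>. (Z \<omega>, G \<omega>)) - cond_mutual_info Q X Y Z\<bar> \<le> Ent Q G"
proof -
  have f: "finite_Ent Q (\<lambda>\<omega>. (X \<omega>, Y \<omega>, Z \<omega>))" "finite_Ent Q (\<lambda>\<omega>. (G \<omega>, X \<omega>, Z \<omega>))"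
      "finite_Ent Q (\<lambda>\<omega>. (G \<omega>, X \<omega>, Y \<omega>, Z \<omega>))"
      "finite_Ent Q (\<lambda>\<omega>. (G \<omega>, Z \<omega>))" "finite_Ent Q (\<lambda>\<omega>. (G \<omega>, Y \<omega>, Z \<omega>))"
    by (rule finite_Ent_mono[OF fin], simp)+
  have cong: "Ent Q (\<lambda>\<omega>. (X \<omega>, Y \<omega>, Z \<omega>, G \<omega>)) = Ent Q (\<lambda>\<omega>. (G \<omega>, X \<omega>, Y \<omega>, Z \<omega>))"
      "Ent Q (\<lambda>\<omega>. (X \<omega>, Z \<omega>, G \<omega>)) = Ent Q (\<lambda>\<omega>. (G \<omega>, X \<omega>, Z \<omega>))"
      "Ent Q (\<lambda>\<omega>. (Y \<omega>, Z \<omega>, G \<omega>)) = Ent Q (\<lambda>\<omega>. (G \<omega>, Y \<omega>, Z \<omega>))"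
      "Ent Q (\<lambda>\<omega>. (Z \<omega>, G \<omega>)) = Ent Q (\<lambda>\<omega>. (G \<omega>, Z \<omega>))"
    by (rule Ent_cong_fibres, auto)+
  have "Ent Q (\<lambda>\<omega>. (X \<omega>, Z \<omega>)) \<le> Ent Q (\<lambda>\<omega>. (G \<omega>, X \<omega>, Z \<omega>))"
    by (rule Ent_mono[OF f(2)]) simp
  moreover have "Ent Q (\<lambda>\<omega>. (X \<omega>, Y \<omega>, Z \<omega>)) \<le> Ent Q (\<lambda>\<omega>. (G \<omega>, X \<omega>, Y \<omega>, Z \<omega>))"
    by (rule Ent_mono[OF f(3)]) simp
  moreover note Ent_submodular[OF f(2)] Ent_submodular[OF f(3)] Ent_Pair_le[OF f(4)] Ent_Pair_le[OF f(5)]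
    cond_mutual_info_eq_expectation(2)[OF fin] cond_mutual_info_eq_expectation(2)[OF f(1)]
  ultimately show ?thesis
    unfolding cong by linarith
qed

section \<open>Stability of conditional mutual information\<close>

text \<open>Revealing \<open>X\<close> exactly where \<open>Z\<close> and \<open>Z'\<close> differ makes the conditional mutual
  informations given \<open>Z\<close> and given \<open>Z'\<close> equal: where \<open>X\<close> is revealed both information densities
  vanish, and elsewhere they agree.\<close>

lemma cond_mutual_info_le_of_coupling:
  fixes X :: "'o \<Rightarrow> 'a::countable" and Y :: "'o \<Rightarrow> 'b::countable" and Z Z' :: "'o \<Rightarrow> 'c::countable"
  assumes fin: "finite_Ent Q (\<lambda>\<omega>. (X \<omega>, Y \<omega>, Z \<omega>))" "finite_Ent Q (\<lambda>\<omega>. (X \<omega>, Y \<omega>, Z' \<omega>))"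
  defines "G \<equiv> \<lambda>\<omega>. if Z \<omega> \<noteq> Z' \<omega> then Some (X \<omega>) else None"
  shows "cond_mutual_info Q X Y Z' \<le> cond_mutual_info Q X Y Z + 2 * Ent Q G"
proof -
  \<comment> \<open>\<open>G\<close> is a function of \<open>X\<close> and the two-valued flag
    \<open>Z \<omega> = Z' \<omega>\<close>, and adjoining such a flag preserves finite
    entropy.\<close>
  have finG: "finite_Ent Q (\<lambda>\<omega>. (X \<omega>, Y \<omega>, C \<omega>, G \<omega>))" if "finite_Ent Q (\<lambda>\<omega>. (X \<omega>, Y \<omega>, C \<omega>))"
    for C :: "'o \<Rightarrow> 'c"
  proof -
    have "finite_Ent Q (\<lambda>\<omega>. ((X \<omega>, Y \<omega>, C \<omega>), Z \<omega> = Z' \<omega>))"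
      using that by (rule finite_Ent_Pair_finite_range) simp
    then show ?thesis
      by (rule finite_Ent_mono) (auto simp: G_def)
  qed
  let ?i = "\<lambda>C \<omega>. surprisal Q (\<lambda>\<omega>. (X \<omega>, C \<omega>, G \<omega>)) \<omega> + surprisal Q (\<lambda>\<omega>. (Y \<omega>, C \<omega>, G \<omega>)) \<omega>
      - surprisal Q (\<lambda>\<omega>. (X \<omega>, Y \<omega>, C \<omega>, G \<omega>)) \<omega> - surprisal Q (\<lambda>\<omega>. (C \<omega>, G \<omega>)) \<omega>"
  have eq: "?i Z \<omega> = ?i Z' \<omega>" for \<omega>
  proof (cases "Z \<omega> = Z' \<omega>")
    case True
    \<comment> \<open>Here \<open>G \<omega>\<close> is \<open>None\<close>, so a point with the
      same value of \<open>G\<close> also has equal \<open>Z\<close> and \<open>Z'\<close>.\<close>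
    then have k: "Z \<omega>' = Z \<omega> \<and> G \<omega>' = G \<omega> \<longleftrightarrow> Z' \<omega>' = Z' \<omega> \<and> G \<omega>' = G \<omega>" for \<omega>'
      by (auto simp: G_def)
    have "surprisal Q (\<lambda>\<omega>. (X \<omega>, Z \<omega>, G \<omega>)) \<omega> = surprisal Q (\<lambda>\<omega>. (X \<omega>, Z' \<omega>, G \<omega>)) \<omega>"
      "surprisal Q (\<lambda>\<omega>. (Y \<omega>, Z \<omega>, G \<omega>)) \<omega> = surprisal Q (\<lambda>\<omega>. (Y \<omega>, Z' \<omega>, G \<omega>)) \<omega>"
      "surprisal Q (\<lambda>\<omega>. (X \<omega>, Y \<omega>, Z \<omega>, G \<omega>)) \<omega> = surprisal Q (\<lambda>\<omega>. (X \<omega>, Y \<omega>, Z' \<omega>, G \<omega>)) \<omega>"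
      "surprisal Q (\<lambda>\<omega>. (Z \<omega>, G \<omega>)) \<omega> = surprisal Q (\<lambda>\<omega>. (Z' \<omega>, G \<omega>)) \<omega>"
      by (intro surprisal_cong; simp only: prod.inject; use k in blast)+
    then show ?thesis by simp
  next
    case False
    then have X: "X \<omega>' = X \<omega>" if "G \<omega>' = G \<omega>" for \<omega>'
      using that by (auto simp: G_def split: if_splits)
    have "?i C \<omega> = 0" for C :: "'o \<Rightarrow> 'c"
    proof -
      have "surprisal Q (\<lambda>\<omega>. (X \<omega>, C \<omega>, G \<omega>)) \<omega> = surprisal Q (\<lambda>\<omega>. (C \<omega>, G \<omega>)) \<omega>"
        "surprisal Q (\<lambda>\<omega>. (X \<omega>, Y \<omega>, C \<omega>, G \<omega>)) \<omega> = surprisal Q (\<lambda>\<omega>. (Y \<omega>, C \<omega>, G \<omega>)) \<omega>"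
        by (intro surprisal_cong; simp only: prod.inject; use X in blast)+
      then show ?thesis by simp
    qed
    then show ?thesis by simp
  qed
  have "cond_mutual_info Q X Y (\<lambda>\<omega>. (Z \<omega>, G \<omega>)) = cond_mutual_info Q X Y (\<lambda>\<omega>. (Z' \<omega>, G \<omega>))"
    unfolding cond_mutual_info_eq_expectation(1)[OF finG[OF fin(1)]]
      cond_mutual_info_eq_expectation(1)[OF finG[OF fin(2)]] using eq by simp
  then show ?thesis
    using abs_cond_mutual_info_Pair_diff_le[OF finG[OF fin(1)]]
      abs_cond_mutual_info_Pair_diff_le[OF finG[OF fin(2)]] by linarith
qed

section \<open>Entropy concentrated on a rare event\<close>

lemma neg_mult_log2_le_one_minus:
  fixes t :: real
  assumes "0 < t"
  shows "- (t * log 2 t) \<le> (1 - t) / ln 2"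
proof -
  have "- ln t \<le> 1 / t - 1"
    using ln_le_minus_one[of "1 / t"] assms by (simp add: ln_div)
  then have "t * - ln t \<le> t * (1 / t - 1)"
    using assms by (intro mult_left_mono) auto
  also have "\<dots> = 1 - t" using assms by (simp add: algebra_simps)
  finally have "- (t * ln t) / ln 2 \<le> (1 - t) / ln 2"
    by (intro divide_right_mono) auto
  then show ?thesis by (simp add: log_def)
qed

text \<open>A uniform rate at which the entropy summand vanishes as \<open>t\<close> tends to 0. It
  comes from the preceding bound at \<open>sqrt t\<close>, since \<open>log 2 t\<close> is twice
  \<open>log 2 (sqrt t)\<close>.\<close>

lemma neg_mult_log2_le_sqrt:
  fixes t :: real
  assumes "0 \<le> t"
  shows "- (t * log 2 t) \<le> 2 * sqrt t / ln 2"
proof (cases "t = 0")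
  case False
  define s where "s = sqrt t"
  have s: "0 < s" "t = s * s"
    using False assms by (simp_all add: s_def)
  have "- (s * log 2 s) \<le> (1 - s) / ln 2"
    by (rule neg_mult_log2_le_one_minus) (rule s)
  also have "\<dots> \<le> 1 / ln 2"
    using s by (intro divide_right_mono) auto
  finally have "2 * s * - (s * log 2 s) \<le> 2 * s * (1 / ln 2)"
    using s by (intro mult_left_mono) auto
  then show ?thesis
    using s by (simp add: s_def[symmetric] log_mult algebra_simps)
qed simp

text \<open>The function - t log t is not monotone on the unit interval; the term
  \<open>p / ln 2\<close> pays for that. Writing \<open>q\<close> as \<open>p * (q / p)\<close>
  splits the logarithm, and the quotient part is bounded by
  \<open>neg_mult_log2_le_one_minus\<close>. The right side stays summable over the atoms of a law
  of finite entropy.\<close>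

lemma neg_mult_log2_mono:
  fixes q p :: real
  assumes "0 \<le> q" "q \<le> p" "p \<le> 1"
  shows "- (q * log 2 q) \<le> - (p * log 2 p) + p / ln 2"
proof (cases "q = 0")
  case True
  have "p * log 2 p \<le> 0"
    using assms by (cases "p = 0") (auto intro!: mult_nonneg_nonpos)
  moreover have "0 \<le> p / ln 2" using assms by simp
  ultimately show ?thesis
    using True by simp
next
  case False
  then have pos: "0 < q" "0 < p" using assms by auto
  have "- (q * log 2 q) = p * - ((q / p) * log 2 (q / p)) + q * - log 2 p"
    using pos by (simp add: log_divide field_simps)
  also have "\<dots> \<le> p * ((1 - q / p) / ln 2) + p * - log 2 p"
  proof (rule add_mono)
    show "p * - ((q / p) * log 2 (q / p)) \<le> p * ((1 - q / p) / ln 2)"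
      using pos by (intro mult_left_mono neg_mult_log2_le_one_minus) auto
    show "q * - log 2 p \<le> p * - log 2 p"
      using assms pos by (intro mult_right_mono) auto
  qed
  also have "p * ((1 - q / p) / ln 2) \<le> p * (1 / ln 2)"
    using pos by (intro mult_left_mono divide_right_mono) auto
  finally show ?thesis by simp
qed

lemma summable_on_infsum_compl_less:
  fixes f :: "'a \<Rightarrow> real"
  assumes f: "f summable_on UNIV" and e: "0 < e"
  obtains A where "finite A" "infsum f (- A) < e"
proof -
  have "(f has_sum infsum f UNIV) UNIV"
    using f by (rule has_sum_infsum)
  then have "eventually (\<lambda>A. dist (sum f A) (infsum f UNIV) < e) (finite_subsets_at_top UNIV)"
    using e unfolding has_sum_def by (rule tendstoD)
  then obtain A where A: "finite A" "dist (sum f A) (infsum f UNIV) < e"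
    unfolding eventually_finite_subsets_at_top by auto
  have "infsum f (A \<union> - A) = infsum f A + infsum f (- A)"
    using f by (intro infsum_Un_disjoint summable_on_subset_banach[OF f]) auto
  then have "infsum f UNIV = sum f A + infsum f (- A)"
    using A(1) by simp
  then have "infsum f (- A) < e"
    using A(2) by (simp add: dist_real_def)
  with A(1) show ?thesis by (rule that)
qed

text \<open>A dominated convergence argument. The atom \<open>Some x\<close> has mass at most
  \<open>pmf p x\<close> and at most \<open>\<delta>\<close>: the first bound controls the terms
  outside a finite set \<open>A\<close>, the second those in \<open>A\<close>, while
  \<open>None\<close> has mass near 1. It matters that \<open>\<delta>\<close> depends on
  \<open>p\<close> and \<open>e\<close> alone, as \<open>Q\<close> is constructed later.\<close>

lemma Ent_on_rare_event_small:
  fixes p :: "'a::countable pmf"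
  assumes fin: "finite_Ent p (\<lambda>x. x)" and e: "0 < e"
  shows "\<exists>\<delta>>0. \<forall>(Q :: 'o pmf) X F. map_pmf X Q = p \<longrightarrow> measure_pmf.prob Q {\<omega>. F \<omega>} \<le> \<delta> \<longrightarrow>
    Ent Q (\<lambda>\<omega>. if F \<omega> then Some (X \<omega>) else None) \<le> e"
proof -
  define f where "f x = - (pmf p x * log 2 (pmf p x)) + pmf p x / ln 2" for x
  have "(\<lambda>x. pmf p x * log 2 (pmf p x)) summable_on UNIV"
    using fin by (simp add: finite_Ent_iff)
  moreover have "pmf p summable_on UNIV"
    using integrable_measure_pmf_iff[of p "\<lambda>_. 1"] by simp
  ultimately have f: "f summable_on UNIV"
    unfolding f_def
    by (intro summable_on_add) (simp_all add: summable_on_uminus divide_inverse summable_on_cmult_left)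
  obtain A where A: "finite A" "infsum f (- A) < e / 2"
    using summable_on_infsum_compl_less[OF f, of "e / 2"] e by auto
  \<comment> \<open>The \<open>card A + 1\<close> terms, from \<open>A\<close> and from
    \<open>None\<close>, share the budget \<open>e / 2\<close> equally.\<close>
  define c where "c = e / (2 * (card A + 1))"
  have c: "0 < c" "(card A + 1) * c = e / 2"
    using e by (auto simp: c_def field_simps)
  \<comment> \<open>The first entry keeps the term of \<open>None\<close> below \<open>c\<close>, by
    the bound \<open>(1 - t) / ln 2\<close>; the second does so for the terms of \<open>A\<close>,
    by the bound \<open>2 * sqrt t / ln 2\<close>.\<close>
  define \<delta> where "\<delta> = min (c * ln 2) ((c * ln 2 / 2)\<^sup>2)"
  have \<delta>: "0 < \<delta>" using c by (simp add: \<delta>_def)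
  have sqrt_\<delta>: "sqrt \<delta> \<le> c * ln 2 / 2"
    using c by (intro real_le_lsqrt) (auto simp: \<delta>_def)
  have "Ent Q (\<lambda>\<omega>. if F \<omega> then Some (X \<omega>) else None) \<le> e"
    if X: "map_pmf X Q = p" and F: "measure_pmf.prob Q {\<omega>. F \<omega>} \<le> \<delta>"
    for Q :: "'o pmf" and X F
  proof -
    define G where "G = (\<lambda>\<omega>. if F \<omega> then Some (X \<omega>) else None)"
    let ?g = "pmf (map_pmf G Q)"
    have "finite_Ent Q X"
      using fin unfolding X[symmetric] finite_Ent_map_pmf .
    then have "finite_Ent Q (\<lambda>\<omega>. (X \<omega>, F \<omega>))"
      by (rule finite_Ent_Pair_finite_range) simp
    then have finG: "finite_Ent Q G"
      by (rule finite_Ent_mono) (auto simp: G_def)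
    have g_Some: "?g (Some x) \<le> pmf p x" "?g (Some x) \<le> \<delta>" for x
    proof -
      show "?g (Some x) \<le> pmf p x"
        unfolding X[symmetric] pmf_map_eq_prob
        by (intro measure_pmf.finite_measure_mono) (auto simp: G_def)
      have "?g (Some x) \<le> measure_pmf.prob Q {\<omega>. F \<omega>}"
        unfolding pmf_map_eq_prob by (intro measure_pmf.finite_measure_mono) (auto simp: G_def)
      then show "?g (Some x) \<le> \<delta>" using F by linarith
    qed
    have "?g None = 1 - measure_pmf.prob Q {\<omega>. F \<omega>}"
      unfolding pmf_map_eq_prob
      by (subst measure_pmf.prob_compl[symmetric]) (auto simp: G_def intro!: arg_cong[where f = "measure_pmf.prob Q"])
    then have g_None: "1 - \<delta> \<le> ?g None" using F by linarith
    define B where "B a = (case a of None \<Rightarrow> c | Some x \<Rightarrow> if x \<in> A then c else f x)" for a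
    have le: "- (?g a * log 2 (?g a)) \<le> B a" for a
    proof (cases a)
      case None
      show ?thesis
      proof (cases "?g None = 0")
        case True
        then show ?thesis using c None by (simp add: B_def)
      next
        case False
        then have "- (?g None * log 2 (?g None)) \<le> (1 - ?g None) / ln 2"
          by (intro neg_mult_log2_le_one_minus) (simp add: pmf_pos)
        also have "\<dots> \<le> c * ln 2 / ln 2"
          using g_None by (intro divide_right_mono) (auto simp: \<delta>_def)
        finally show ?thesis using None by (simp add: B_def)
      qed
    next
      case (Some x)
      show ?thesis
      proof (cases "x \<in> A")
        case True
        have "- (?g (Some x) * log 2 (?g (Some x))) \<le> 2 * sqrt (?g (Some x)) / ln 2"
          by (intro neg_mult_log2_le_sqrt) simp
        also have "\<dots> \<le> 2 * (c * ln 2 / 2) / ln 2"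
          using sqrt_\<delta> g_Some(2)[of x] by (intro divide_right_mono mult_left_mono) (auto intro: order_trans[rotated])
        finally show ?thesis using True Some by (simp add: B_def)
      next
        case False
        have "- (?g (Some x) * log 2 (?g (Some x))) \<le> f x"
          unfolding f_def using g_Some(1)[of x] by (intro neg_mult_log2_mono) (auto simp: pmf_le_1)
        then show ?thesis using False Some by (simp add: B_def)
      qed
    qed
    have "(B has_sum sum B (insert None (Some ` A))) (insert None (Some ` A))"
      using A(1) by (intro has_sum_finite) simp
    moreover have "sum B (insert None (Some ` A)) = e / 2"
    proof -
      have "sum B (insert None (Some ` A)) = (\<Sum>a\<in>insert None (Some ` A). c)"
        by (intro sum.cong) (auto simp: B_def)
      also have "\<dots> = (card A + 1) * c"
        using A(1) by (simp add: card_image card_insert_if)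
      finally show ?thesis using c by simp
    qed
    moreover have "(B has_sum infsum f (- A)) (Some ` (- A))"
    proof -
      have "(f has_sum infsum f (- A)) (- A)"
        by (intro has_sum_infsum summable_on_subset_banach[OF f]) simp
      then have "((B \<circ> Some) has_sum infsum f (- A)) (- A)"
        by (rule has_sum_cong[THEN iffD1, rotated]) (simp add: B_def)
      then show ?thesis by (subst has_sum_reindex) auto
    qed
    ultimately have "(B has_sum (e / 2 + infsum f (- A))) (insert None (Some ` A) \<union> Some ` (- A))"
      by (intro has_sum_Un_disjoint) auto
    moreover have "insert None (Some ` A) \<union> Some ` (- A) = UNIV"
    proof -
      have "a \<in> insert None (Some ` A) \<union> Some ` (- A)" for a by (cases a) auto
      then show ?thesis by blast
    qed
    ultimately have B: "(B has_sum (e / 2 + infsum f (- A))) UNIV" by simp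
    have g: "((\<lambda>a. - (?g a * log 2 (?g a))) has_sum Ent Q G) UNIV"
      using has_sum_infsum[OF finG[unfolded finite_Ent_iff]] by (simp add: Ent_eq has_sum_uminus)
    have "Ent Q G \<le> e / 2 + infsum f (- A)"
      using g B by (rule has_sum_mono) (rule le)
    then show ?thesis
      using A(2) by (simp add: G_def)
  qed
  with \<delta> show ?thesis by blast
qed

text \<open>If every value were missed with probability above \<open>\<delta>\<close>, then on the
  support the surprisal - log s would be at least 1 - s > \<delta>, where s is the probability of
  the fibre, and hence the entropy would be at least \<open>\<delta>\<close>.\<close>

lemma Ent_small_imp_atom:
  assumes fin: "finite_Ent Q U" and small: "Ent Q U < \<delta>"
  shows "\<exists>u. measure_pmf.prob Q {\<omega>. U \<omega> \<noteq> u} \<le> \<delta>"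
proof (rule ccontr)
  assume "\<not> ?thesis"
  then have large: "\<delta> < measure_pmf.prob Q {\<omega>. U \<omega> \<noteq> u}" for u
    by (simp add: not_le)
  have "measure_pmf.expectation Q (\<lambda>_. \<delta>) \<le> measure_pmf.expectation Q (surprisal Q U)"
  proof (rule integral_mono_AE)
    show "AE \<omega> in measure_pmf Q. \<delta> \<le> surprisal Q U \<omega>"
      unfolding AE_measure_pmf_iff
    proof
      fix \<omega> assume \<omega>: "\<omega> \<in> set_pmf Q"
      define s where "s = measure_pmf.prob Q {\<omega>'. U \<omega>' = U \<omega>}"
      have s: "0 < s" unfolding s_def by (rule prob_fibre_pos[OF \<omega>])
      have "measure_pmf.prob Q {\<omega>'. U \<omega>' \<noteq> U \<omega>} = 1 - s"
        unfolding s_def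
        by (subst measure_pmf.prob_compl[symmetric]) (auto intro!: arg_cong[where f = "measure_pmf.prob Q"])
      then have "\<delta> \<le> - ln s"
        using large[of "U \<omega>"] ln_le_minus_one[OF s] by linarith
      \<comment> \<open>Passing to base 2 only increases the value, because
        \<open>ln 2 \<le> 1\<close>.\<close>
      also have "- ln s \<le> - ln s / ln 2"
      proof -
        have "ln s \<le> 0" using s unfolding s_def by simp
        moreover have "ln 2 \<le> (1::real)" using ln_le_minus_one[of 2] by simp
        ultimately show ?thesis
          using mult_left_le[of "ln 2" "- ln s"] by (simp add: field_simps)
      qed
      finally show "\<delta> \<le> surprisal Q U \<omega>" by (simp add: surprisal_def s_def log_def)
    qed
  qed (use fin in \<open>simp_all add: finite_Ent_iff_integrable\<close>)
  then show False using small by (simp add: Ent_eq_expectation)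
qed

section \<open>Intrinsic information\<close>

lemma cond_mutual_info_process_nonneg:
  fixes R :: "('x::countable \<times> 'y::countable \<times> 'w::countable) pmf"
  assumes "finite_Ent R (\<lambda>\<omega>. \<omega>)"
  shows "0 \<le> cond_mutual_info R (\<lambda>(x, y, w). x) (\<lambda>(x, y, w). y) (\<lambda>(x, y, w). w)"
  by (rule cond_mutual_info_nonneg, rule finite_Ent_mono[OF assms]) simp

text \<open>A real infimum is a lower bound only of a family bounded below; nonnegativity of
  conditional mutual information supplies that.\<close>

lemma intrinsic_info_le:
  fixes P :: "('x::countable \<times> 'y::countable \<times> 'z::countable) pmf" and W :: "'z \<Rightarrow> nat pmf"
  assumes "finite_Ent (process P W) (\<lambda>\<omega>. \<omega>)"
  shows "intrinsic_info P \<le> cond_mutual_info (process P W) (\<lambda>(x, y, w). x) (\<lambda>(x, y, w). y) (\<lambda>(x, y, w). w)"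
  unfolding intrinsic_info_def
proof (rule cINF_lower)
  show "bdd_below ((\<lambda>W. cond_mutual_info (process P W) (\<lambda>(x, y, w). x) (\<lambda>(x, y, w). y) (\<lambda>(x, y, w). w)) `
      {W :: 'z \<Rightarrow> nat pmf. finite_Ent (process P W) (\<lambda>\<omega>. \<omega>)})"
    by (rule bdd_belowI[of _ 0]) (auto intro: cond_mutual_info_process_nonneg)
qed (use assms in simp)

lemma process_return: "process P (\<lambda>z. return_pmf (h z)) = map_pmf (\<lambda>(x, y, z). (x, y, h z)) P"
  by (simp add: process_def map_pmf_def bind_return_pmf case_prod_unfold)

lemma adjoin_return: "adjoin P (\<lambda>_. return_pmf c) = map_pmf (\<lambda>(x, y, z). (x, y, z, c)) P"
  by (simp add: adjoin_def map_pmf_def bind_return_pmf case_prod_unfold)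

lemma finite_Ent_process_const:
  assumes "finite_Ent P (\<lambda>\<omega>. \<omega>)"
  shows "finite_Ent (process P (\<lambda>_. return_pmf c)) (\<lambda>\<omega>. \<omega>)"
  unfolding process_return finite_Ent_map_pmf by (rule finite_Ent_mono[OF assms]) simp

lemma finite_Ent_adjoin_const:
  assumes "finite_Ent P (\<lambda>\<omega>. \<omega>)"
  shows "finite_Ent (adjoin P (\<lambda>_. return_pmf c)) (\<lambda>\<omega>. \<omega>)"
  unfolding adjoin_return finite_Ent_map_pmf by (rule finite_Ent_mono[OF assms]) simp

lemma intrinsic_info_nonneg:
  assumes "finite_Ent P (\<lambda>\<omega>. \<omega>)"
  shows "0 \<le> intrinsic_info P"
  unfolding intrinsic_info_def
  by (rule cINF_greatest)
    (use finite_Ent_process_const[OF assms] in \<open>auto intro: cond_mutual_info_process_nonneg\<close>)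

lemma intrinsic_info_less_obtain:
  fixes P :: "('x::countable \<times> 'y::countable \<times> 'z::countable) pmf"
  assumes "finite_Ent P (\<lambda>\<omega>. \<omega>)" and "intrinsic_info P < e"
  obtains W :: "'z \<Rightarrow> nat pmf" where "finite_Ent (process P W) (\<lambda>\<omega>. \<omega>)"
    and "cond_mutual_info (process P W) (\<lambda>(x, y, w). x) (\<lambda>(x, y, w). y) (\<lambda>(x, y, w). w) < e"
proof -
  have "{W :: 'z \<Rightarrow> nat pmf. finite_Ent (process P W) (\<lambda>\<omega>. \<omega>)} \<noteq> {}"
    using finite_Ent_process_const[OF assms(1)] by blast
  from cInf_lessD[OF _ assms(2)[unfolded intrinsic_info_def]] this that show ?thesis
    by blast
qed

lemma reduced_intrinsic_info_nonneg:
  assumes "finite_Ent P (\<lambda>\<omega>. \<omega>)"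
  shows "0 \<le> reduced_intrinsic_info P"
  unfolding reduced_intrinsic_info_def
  by (rule cINF_greatest)
    (use finite_Ent_adjoin_const[OF assms] in \<open>auto intro: add_nonneg_nonneg intrinsic_info_nonneg Ent_nonneg\<close>)

lemma reduced_intrinsic_info_less_obtain:
  fixes P :: "('x::countable \<times> 'y::countable \<times> 'z::countable) pmf"
  assumes "finite_Ent P (\<lambda>\<omega>. \<omega>)" and "reduced_intrinsic_info P < e"
  obtains V :: "'x \<times> 'y \<times> 'z \<Rightarrow> nat pmf" where "finite_Ent (adjoin P V) (\<lambda>\<omega>. \<omega>)"
    and "intrinsic_info (adjoin P V) + Ent (adjoin P V) (\<lambda>(x, y, z, u). u) < e"
proof -
  have "{V :: 'x \<times> 'y \<times> 'z \<Rightarrow> nat pmf. finite_Ent (adjoin P V) (\<lambda>\<omega>. \<omega>)} \<noteq> {}"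
    using finite_Ent_adjoin_const[OF assms(1)] by blast
  from cInf_lessD[OF _ assms(2)[unfolded reduced_intrinsic_info_def]] this that show ?thesis
    by blast
qed

lemma Ent_const: "Ent Q (\<lambda>_. c) = 0"
  by (simp add: Ent_eq_expectation surprisal_def[abs_def])

text \<open>A constant \<open>U\<close> has entropy zero, and every channel from \<open>Z\<close> is
  a channel from the pair that ignores \<open>U\<close>.\<close>

lemma reduced_intrinsic_info_le_intrinsic_info:
  fixes P :: "('x::countable \<times> 'y::countable \<times> 'z::countable) pmf"
  assumes fin: "finite_Ent P (\<lambda>\<omega>. \<omega>)"
  shows "reduced_intrinsic_info P \<le> intrinsic_info P"
proof -
  define V :: "'x \<times> 'y \<times> 'z \<Rightarrow> nat pmf" where "V = (\<lambda>_. return_pmf 0)"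
  have "reduced_intrinsic_info P \<le> intrinsic_info (adjoin P V) + Ent (adjoin P V) (\<lambda>(x, y, z, u). u)"
    unfolding reduced_intrinsic_info_def
  proof (rule cINF_lower)
    show "bdd_below ((\<lambda>V. intrinsic_info (adjoin P V) + Ent (adjoin P V) (\<lambda>(x, y, z, u). u)) `
        {V :: 'x \<times> 'y \<times> 'z \<Rightarrow> nat pmf. finite_Ent (adjoin P V) (\<lambda>\<omega>. \<omega>)})"
      by (rule bdd_belowI[of _ 0]) (auto intro: add_nonneg_nonneg intrinsic_info_nonneg Ent_nonneg)
  qed (use finite_Ent_adjoin_const[OF fin] in \<open>simp add: V_def\<close>)
  also have "Ent (adjoin P V) (\<lambda>(x, y, z, u). u) = 0"
    by (simp add: V_def adjoin_return Ent_map_pmf case_prod_unfold Ent_const)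
  also have "intrinsic_info (adjoin P V) \<le> intrinsic_info P"
    unfolding intrinsic_info_def[of P]
  proof (rule cINF_greatest)
    show "{W :: 'z \<Rightarrow> nat pmf. finite_Ent (process P W) (\<lambda>\<omega>. \<omega>)} \<noteq> {}"
      using finite_Ent_process_const[OF fin] by blast
    fix W :: "'z \<Rightarrow> nat pmf" assume W: "W \<in> {W. finite_Ent (process P W) (\<lambda>\<omega>. \<omega>)}"
    have "process (adjoin P V) (\<lambda>(z, u). W z) = process P W"
      by (simp add: V_def adjoin_return process_def bind_map_pmf case_prod_unfold)
    then show "intrinsic_info (adjoin P V)
        \<le> cond_mutual_info (process P W) (\<lambda>(x, y, w). x) (\<lambda>(x, y, w). y) (\<lambda>(x, y, w). w)"
      using intrinsic_info_le[of "adjoin P V" "\<lambda>(z, u). W z"] W by simp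
  qed
  finally show ?thesis by simp
qed

section \<open>The coupling with a channel from \<open>Z\<close> alone\<close>

lemma prob_greater_small:
  fixes D :: "nat pmf"
  assumes "0 < e"
  shows "\<exists>N. measure_pmf.prob D {n. N < n} \<le> e"
proof -
  have "(\<lambda>N. measure_pmf.prob D {n. N < n}) \<longlonglongrightarrow> measure_pmf.prob D (\<Inter>N. {n. N < n})"
    by (rule measure_pmf.finite_Lim_measure_decseq) (auto simp: decseq_def)
  also have "(\<Inter>N. {n. N < n}) = ({} :: nat set)"
    by auto
  finally have "(\<lambda>N. measure_pmf.prob D {n. N < n}) \<longlonglongrightarrow> 0"
    by simp
  then have "eventually (\<lambda>N. measure_pmf.prob D {n. N < n} < e) sequentially"
    using assms by (rule order_tendstoD)
  then show ?thesis
    by (auto simp: eventually_sequentially intro: less_imp_le)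
qed

text \<open>The channel \<open>\<lambda>z. W (z, u\<^sub>0)\<close> is truncated at \<open>N\<close> because its output may have infinite entropy:
  the finite entropy of \<open>process (adjoin P V) W\<close> says nothing about \<open>W (z, u\<^sub>0)\<close> for a value \<open>z\<close>
  that never occurs together with \<open>u\<^sub>0\<close>.\<close>

lemma intrinsic_info_le_of_reduced:
  fixes P :: "('x::countable \<times> 'y::countable \<times> 'z::countable) pmf"
  assumes fin: "finite_Ent P (\<lambda>\<omega>. \<omega>)" and red: "reduced_intrinsic_info P = 0" and e: "0 < e"
  shows "intrinsic_info P \<le> 3 * e"
proof -
  have "finite_Ent P fst"
    by (rule finite_Ent_mono[OF fin]) simp
  then have "finite_Ent (map_pmf fst P) (\<lambda>x. x)"
    by (simp add: finite_Ent_map_pmf)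
  \<comment> \<open>The threshold \<open>\<delta>\<close> is determined by the law of
    \<open>X\<close> before \<open>V\<close> and \<open>W\<close> are chosen. The type instance is
    the sample space of the coupling \<open>Q\<close>.\<close>
  from Ent_on_rare_event_small[OF this e, where ?'o = "'x \<times> 'y \<times> nat \<times> nat \<times> nat"]
  obtain \<delta> where \<delta>: "0 < \<delta>"
    and rare: "\<And>(Q :: ('x \<times> 'y \<times> nat \<times> nat \<times> nat) pmf) X F. map_pmf X Q = map_pmf fst P \<Longrightarrow>
      measure_pmf.prob Q {\<omega>. F \<omega>} \<le> \<delta> \<Longrightarrow> Ent Q (\<lambda>\<omega>. if F \<omega> then Some (X \<omega>) else None) \<le> e"
    by blast
  obtain V :: "'x \<times> 'y \<times> 'z \<Rightarrow> nat pmf" where V: "finite_Ent (adjoin P V) (\<lambda>\<omega>. \<omega>)"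
    \<comment> \<open>The bound \<open>e\<close> is for the information and
      \<open>\<delta> / 2\<close> for the atom of \<open>U\<close>; the other half of
      \<open>\<delta>\<close> is reserved for the truncation at \<open>N\<close>.\<close>
    and V_less: "intrinsic_info (adjoin P V) + Ent (adjoin P V) (\<lambda>(x, y, z, u). u) < min e (\<delta> / 2)"
    using reduced_intrinsic_info_less_obtain[OF fin, of "min e (\<delta> / 2)"] red e \<delta> by auto
  have "intrinsic_info (adjoin P V) < e" "Ent (adjoin P V) (\<lambda>(x, y, z, u). u) < \<delta> / 2"
    using V_less intrinsic_info_nonneg[OF V] Ent_nonneg[of "adjoin P V" "\<lambda>(x, y, z, u). u"] by linarith+
  moreover have "finite_Ent (adjoin P V) (\<lambda>(x, y, z, u). u)"
    by (rule finite_Ent_mono[OF V]) simp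
  ultimately obtain u\<^sub>0 and W :: "'z \<times> nat \<Rightarrow> nat pmf"
    where u\<^sub>0: "measure_pmf.prob (adjoin P V) {\<omega>. (\<lambda>(x, y, z, u). u) \<omega> \<noteq> u\<^sub>0} \<le> \<delta> / 2"
      and W: "finite_Ent (process (adjoin P V) W) (\<lambda>\<omega>. \<omega>)"
      and W_less: "cond_mutual_info (process (adjoin P V) W) (\<lambda>(x, y, w). x) (\<lambda>(x, y, w). y) (\<lambda>(x, y, w). w) < e"
    using Ent_small_imp_atom intrinsic_info_less_obtain[OF V] by metis
  \<comment> \<open>Here \<open>w\<close> is the output of the true channel and \<open>v\<close>
    that of the channel pretending that \<open>U\<close> equals \<open>u\<^sub>0\<close>. They share
    one draw when the pretence is right and are drawn separately otherwise. Given \<open>z\<close>,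
    the draw of \<open>v\<close> does not depend on \<open>u\<close>, so \<open>v\<close> arises
    from \<open>Z\<close> alone.\<close>
  define Q :: "('x \<times> 'y \<times> nat \<times> nat \<times> nat) pmf" where
    "Q = do {(x, y, z) \<leftarrow> P; u \<leftarrow> V (x, y, z); v \<leftarrow> W (z, u\<^sub>0);
       w \<leftarrow> (if u = u\<^sub>0 then return_pmf v else W (z, u)); return_pmf (x, y, u, v, w)}"
  obtain N where N: "measure_pmf.prob (map_pmf (\<lambda>(x, y, u, v, w). v) Q) {n. N < n} \<le> \<delta> / 2"
    using prob_greater_small[OF half_gt_zero[OF \<delta>]] by blast
  define X where "X = (\<lambda>(x :: 'x, y :: 'y, u :: nat, v :: nat, w :: nat). x)"
  define Y where "Y = (\<lambda>(x :: 'x, y :: 'y, u :: nat, v :: nat, w :: nat). y)"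
  define Z where "Z = (\<lambda>(x :: 'x, y :: 'y, u :: nat, v :: nat, w :: nat). w)"
  define Z' where "Z' = (\<lambda>(x :: 'x, y :: 'y, u :: nat, v :: nat, w :: nat). min v N)"
  define W' where "W' z = map_pmf (\<lambda>v. min v N) (W (z, u\<^sub>0))" for z

  have law_X: "map_pmf X Q = map_pmf fst P"
    by (simp add: Q_def X_def map_pmf_def bind_assoc_pmf bind_return_pmf case_prod_unfold)
  have law_U: "map_pmf (\<lambda>(x, y, u, v, w). u) Q = map_pmf (\<lambda>(x, y, z, u). u) (adjoin P V)"
    by (simp add: Q_def adjoin_def map_pmf_def bind_assoc_pmf bind_return_pmf case_prod_unfold)
  have law_Z': "map_pmf (\<lambda>\<omega>. (X \<omega>, Y \<omega>, Z' \<omega>)) Q = process P W'"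
    by (simp add: Q_def X_def Y_def Z'_def W'_def process_def map_pmf_def bind_assoc_pmf bind_return_pmf
        case_prod_unfold)
  \<comment> \<open>Whether the draw \<open>v\<close> is reused or discarded, \<open>w\<close> has
    the law \<open>W (z, u)\<close>.\<close>
  have "bind_pmf (W (z, u\<^sub>0)) (\<lambda>v. bind_pmf (if u = u\<^sub>0 then return_pmf v else W (z, u)) f) = bind_pmf (W (z, u)) f"
    for z u and f :: "nat \<Rightarrow> ('x \<times> 'y \<times> nat) pmf"
    by (cases "u = u\<^sub>0") (simp_all add: bind_return_pmf)
  then have law_Z: "map_pmf (\<lambda>\<omega>. (X \<omega>, Y \<omega>, Z \<omega>)) Q = process (adjoin P V) W"
    by (simp add: Q_def X_def Y_def Z_def process_def adjoin_def map_pmf_def bind_assoc_pmf bind_return_pmf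
        case_prod_unfold)

  have fin_Z: "finite_Ent Q (\<lambda>\<omega>. (X \<omega>, Y \<omega>, Z \<omega>))"
    using W unfolding law_Z[symmetric] finite_Ent_map_pmf .
  \<comment> \<open>Truncation gives \<open>Z'\<close> a finite range, so the pair inherits finite
    entropy from \<open>(X, Y)\<close>.\<close>
  have "finite_Ent Q (\<lambda>\<omega>. ((X \<omega>, Y \<omega>), Z' \<omega>))"
  proof (rule finite_Ent_Pair_finite_range)
    show "finite_Ent Q (\<lambda>\<omega>. (X \<omega>, Y \<omega>))"
      by (rule finite_Ent_mono[OF fin_Z]) simp
    have "range Z' \<subseteq> {..N}"
      by (auto simp: Z'_def)
    then show "finite (range Z')"
      by (rule finite_subset) simp
  qed
  then have fin_Z': "finite_Ent Q (\<lambda>\<omega>. (X \<omega>, Y \<omega>, Z' \<omega>))"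
    by (rule finite_Ent_mono) simp

  have "measure_pmf.prob Q {\<omega>. Z \<omega> \<noteq> Z' \<omega>}
      \<le> measure_pmf.prob Q ({\<omega>. (\<lambda>(x, y, u, v, w). u) \<omega> \<noteq> u\<^sub>0} \<union> {\<omega>. N < (\<lambda>(x, y, u, v, w). v) \<omega>})"
  \<comment> \<open>Outside both events \<open>w = v\<close> and \<open>min v N = v\<close>. The
    inclusion holds only almost everywhere, since \<open>u = u\<^sub>0\<close> forces
    \<open>w = v\<close> only on the support of \<open>Q\<close>.\<close>
  proof (rule measure_pmf.finite_measure_mono_AE)
    show "AE \<omega> in measure_pmf Q. \<omega> \<in> {\<omega>. Z \<omega> \<noteq> Z' \<omega>} \<longrightarrow>
        \<omega> \<in> {\<omega>. (\<lambda>(x, y, u, v, w). u) \<omega> \<noteq> u\<^sub>0} \<union> {\<omega>. N < (\<lambda>(x, y, u, v, w). v) \<omega>}"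
      by (auto simp: AE_measure_pmf_iff Q_def Z_def Z'_def split: if_splits)
  qed simp
  also have "\<dots> \<le> measure_pmf.prob Q {\<omega>. (\<lambda>(x, y, u, v, w). u) \<omega> \<noteq> u\<^sub>0}
      + measure_pmf.prob Q {\<omega>. N < (\<lambda>(x, y, u, v, w). v) \<omega>}"
    by (rule measure_Un_le) auto
  also have "measure_pmf.prob Q {\<omega>. (\<lambda>(x, y, u, v, w). u) \<omega> \<noteq> u\<^sub>0} \<le> \<delta> / 2"
  proof -
    have "measure_pmf.prob (map_pmf (\<lambda>(x, y, u, v, w). u) Q) {u. u \<noteq> u\<^sub>0}
        = measure_pmf.prob (adjoin P V) {\<omega>. (\<lambda>(x, y, z, u). u) \<omega> \<noteq> u\<^sub>0}"
      unfolding law_U by (simp add: vimage_def)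
    then show ?thesis
      using u\<^sub>0 by (simp add: vimage_def)
  qed
  also have "measure_pmf.prob Q {\<omega>. N < (\<lambda>(x, y, u, v, w). v) \<omega>} \<le> \<delta> / 2"
    using N by (simp add: vimage_def)
  finally have "measure_pmf.prob Q {\<omega>. Z \<omega> \<noteq> Z' \<omega>} \<le> \<delta>"
    by simp
  then have "Ent Q (\<lambda>\<omega>. if Z \<omega> \<noteq> Z' \<omega> then Some (X \<omega>) else None) \<le> e"
    by (rule rare[OF law_X])
  moreover have "cond_mutual_info Q X Y Z < e"
    using W_less unfolding law_Z[symmetric] cond_mutual_info_map_pmf by simp
  moreover have "intrinsic_info P \<le> cond_mutual_info Q X Y Z'"
  proof -
    have "finite_Ent (process P W') (\<lambda>\<omega>. \<omega>)"
      using fin_Z' unfolding law_Z'[symmetric] finite_Ent_map_pmf .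
    from intrinsic_info_le[OF this] show ?thesis
      unfolding law_Z'[symmetric] cond_mutual_info_map_pmf by simp
  qed
  \<comment> \<open>One \<open>e\<close> comes from the information given \<open>Z\<close>, two more
    from twice the entropy of the revealed variable.\<close>
  ultimately show ?thesis
    using cond_mutual_info_le_of_coupling[OF fin_Z fin_Z'] by linarith
qed

theorem mainTheorem1:
  fixes P :: "('x::countable \<times> 'y::countable \<times> 'z::countable) pmf"
  assumes "finite_Ent P (\<lambda>\<omega>. \<omega>)"
  shows "reduced_intrinsic_info P = 0 \<longleftrightarrow> intrinsic_info P = 0"
proof
  assume red: "reduced_intrinsic_info P = 0"
  have "intrinsic_info P \<le> 0"
  proof (rule field_le_epsilon)
    fix e :: real assume "0 < e"
    then show "intrinsic_info P \<le> 0 + e"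
      using intrinsic_info_le_of_reduced[OF assms red, of "e / 3"] by simp
  qed
  with intrinsic_info_nonneg[OF assms] show "intrinsic_info P = 0" by simp
next
  assume "intrinsic_info P = 0"
  with reduced_intrinsic_info_le_intrinsic_info[OF assms] reduced_intrinsic_info_nonneg[OF assms]
  show "reduced_intrinsic_info P = 0" by simp
qed

end
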